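(* For every positive integer $n$, both $$\frac{2}{3n(n+1)}\sum_{k=1}^{n}(-1)^{n-k}k^{2}D_{k}D_{k-1}\qquad\text{and}\qquad \frac{1}{n}\sum_{k=1}^{n}(-1)^{n-k}(4k^{2}+2k-1)D_{k-1}s_{k}$$ are positive odd integers.
   Context: For $n\in\mathbb{N}=\{0,1,2,\dots\}$, $D_n$ is the $n$-th central Delannoy number, $D_n=\sum_{k=0}^{n}\binom{n}{k}\binom{n+k}{k}$. For an integer $n\ge 1$, $s_n$ is the $n$-th little Schröder number, $s_n=\sum_{k=1}^{n}\frac1n\binom{n}{k}\binom{n}{k-1}2^{n-k}$. *)

theory Defs
  imports Complex_Main
begin

definition delannoy :: "nat \<Rightarrow> nat" where
  "delannoy n = (\<Sum>k=0..n. (n choose k) * ((n + k) choose k))"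

(* Only meaningful for n \<ge> 1.  Real-valued because the individual summands need not be
   integers, although the sum is. *)
definition little_schroeder :: "nat \<Rightarrow> real" where
  "little_schroeder n =
     (\<Sum>k=1..n. 1 / real n * real (n choose k) * real (n choose (k - 1)) * 2 ^ (n - k))"

definition positive_odd_integer :: "real \<Rightarrow> bool" where
  "positive_odd_integer x \<longleftrightarrow> (\<exists>m::int. x = real_of_int m \<and> m > 0 \<and> odd m)"

end

theory Submission
  imports Defs
begin

text \<open>
  The central Delannoy number \<open>D\<^sub>n\<close> is the value of the Legendre polynomial \<open>P\<^sub>n\<close> at 3. Clausen's formula
  writes \<open>P\<^sub>n(z)\<^sup>2\<close> as a polynomial in \<open>y = (z\<^sup>2 - 1) / 4\<close> with simple coefficients, and
  \<open>n * P\<^sub>n(z) * P\<^sub>n\<^sub>-\<^sub>1(z)\<close> is \<open>z\<close> times another such polynomial. Both formulas follow from the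
  three-term recurrence of the Legendre polynomials (\<open>delannoy_poly_quadratic\<close>). At \<open>z = 3\<close> one has
  \<open>y = 2\<close>, so \<open>D\<^sub>k\<^sup>2\<close> and \<open>k * D\<^sub>k * D\<^sub>k\<^sub>-\<^sub>1\<close> become sums over \<open>j\<close> of \<open>2 ^ j\<close> times a product of binomial
  coefficients. The little Schroeder numbers enter by
  \<open>4 * (k + 1) * s\<^sub>k = 3 * D\<^sub>k - D\<^sub>k\<^sub>-\<^sub>1\<close> (\<open>little_schroeder_delannoy\<close>), which turns \<open>D\<^sub>k\<^sub>-\<^sub>1 * s\<^sub>k\<close> into a
  combination of the same two quantities.

  For each fixed \<open>j\<close> the alternating sum over \<open>k\<close> now telescopes (\<open>alternating_delannoy_sum\<close>,
  \<open>alternating_schroeder_sum\<close>); this depends on the weights \<open>k\<^sup>2\<close> and \<open>4 * k\<^sup>2 + 2 * k - 1\<close>.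
  After division by \<open>3 * n * (n + 1) / 2\<close> and by \<open>n\<close>, respectively, the results are sums of \<open>2 ^ j\<close> times
  natural numbers (\<open>first_sum_closed_form\<close>, \<open>second_sum_closed_form\<close>). The term for \<open>j = 0\<close> is odd in both:
  it equals 1 in the first sum and \<open>2 * (n + 1) + 1\<close> in the second. All other terms are even, so both
  numbers are odd and, being natural numbers, positive.
\<close>

section \<open>Coefficients of Legendre polynomials and of their squares\<close>

definition delannoy_coeff :: "nat \<Rightarrow> nat \<Rightarrow> real" where
  "delannoy_coeff n j = real (n choose j) * real ((n + j) choose j)"

text \<open>This is the Legendre polynomial \<open>P\<^sub>n\<close> at the argument \<open>2 * x + 1\<close>; the central Delannoy numbers
  are its values at \<open>x = 1\<close>.\<close>
definition delannoy_poly :: "nat \<Rightarrow> real \<Rightarrow> real" where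
  "delannoy_poly n x = (\<Sum>j\<le>n. delannoy_coeff n j * x ^ j)"

text \<open>These are the coefficients of the hypergeometric series in Clausen's formula for the square of a
  Legendre polynomial.\<close>
definition clausen_coeff :: "nat \<Rightarrow> nat \<Rightarrow> real" where
  "clausen_coeff n j = delannoy_coeff n j * real ((2 * j) choose j)"

lemma delannoy_coeff_0 [simp]: "delannoy_coeff n 0 = 1"
  by (simp add: delannoy_coeff_def)

lemma clausen_coeff_0 [simp]: "clausen_coeff n 0 = 1"
  by (simp add: clausen_coeff_def)

lemma delannoy_coeff_eq_0: "n < j \<Longrightarrow> delannoy_coeff n j = 0"
  by (simp add: delannoy_coeff_def)

lemma clausen_coeff_eq_0: "n < j \<Longrightarrow> clausen_coeff n j = 0"
  by (simp add: clausen_coeff_def delannoy_coeff_eq_0)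

lemma binomial_absorb_real:
  "(real j + 1) * real (Suc n choose Suc j) = (real n + 1) * real (n choose j)"
  using arg_cong[OF Suc_times_binomial_eq[of n j], of real]
  by (simp add: algebra_simps del: binomial_Suc_Suc)

lemma binomial_step_real:
  "(real j + 1) * real (n choose Suc j) = (real n - real j) * real (n choose j)"
  using binomial_absorb_real[of j n] by (simp add: algebra_simps)

lemma binomial_lower_step_real:
  "(real n + 1) * real ((Suc n + j) choose j) = (real n + real j + 1) * real ((n + j) choose j)"
proof -
  have upper: "(Suc n + j) choose j = Suc (n + j) choose Suc n"
    using binomial_symmetric[of j "Suc n + j"] by simp
  have lower: "(n + j) choose j = (n + j) choose n"
    using binomial_symmetric[of j "n + j"] by simp
  show ?thesis
    unfolding upper lower binomial_absorb_real[of n "n + j"] of_nat_add ..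
qed

text \<open>Up to the factor \<open>(j!)\<^sup>2\<close>, \<open>delannoy_coeff n j\<close> is the product of the \<open>2 * j\<close> consecutive integers
  \<open>n - j + 1, \<dots>, n + j\<close>. Raising \<open>j\<close>, with \<open>n\<close> fixed or raised or lowered by one, only adds two factors at
  the ends of this range. So the rules below express every neighbouring coefficient through one base
  coefficient with polynomial cofactors, and identities between neighbours become polynomial identities;
  no rule divides by \<open>n - j\<close>, which may vanish.\<close>
lemma delannoy_coeff_Suc:
  "(real j + 1)^2 * delannoy_coeff n (Suc j)
     = (real n - real j) * (real n + real j + 1) * delannoy_coeff n j"
proof -
  have "(real j + 1)^2 * delannoy_coeff n (Suc j) =
     ((real j + 1) * real (n choose Suc j)) * ((real j + 1) * real (Suc (n + j) choose Suc j))"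
    by (simp add: delannoy_coeff_def power2_eq_square del: binomial_Suc_Suc)
  also have "\<dots> = ((real n - real j) * real (n choose j)) * ((real n + real j + 1) * real ((n + j) choose j))"
    unfolding binomial_step_real[of j n] binomial_absorb_real[of j "n + j"] by simp
  finally show ?thesis by (simp add: delannoy_coeff_def)
qed

lemma delannoy_coeff_Suc_left:
  "(real n + 1 - real j) * delannoy_coeff (Suc n) j = (real n + 1 + real j) * delannoy_coeff n j"
proof -
  have pascal: "(real n + 1 - real j) * real (Suc n choose j) = (real n + 1) * real (n choose j)"
    using binomial_step_real[of j "Suc n"] binomial_absorb_real[of j n] by (simp del: binomial_Suc_Suc)
  have "(real n + 1) * ((real n + 1 - real j) * delannoy_coeff (Suc n) j)
      = ((real n + 1 - real j) * real (Suc n choose j)) * ((real n + 1) * real ((Suc n + j) choose j))"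
    by (simp add: delannoy_coeff_def)
  also have "\<dots> = (real n + 1) * ((real n + 1 + real j) * delannoy_coeff n j)"
    unfolding pascal binomial_lower_step_real by (simp add: delannoy_coeff_def)
  finally show ?thesis
    by (smt (verit) mult_cancel_left of_nat_0_le_iff)
qed

lemma delannoy_coeff_Suc_Suc:
  "(real j + 1)^2 * delannoy_coeff (Suc n) (Suc j)
     = (real n + real j + 1) * (real n + real j + 2) * delannoy_coeff n j"
  using delannoy_coeff_Suc[of j "Suc n"] delannoy_coeff_Suc_left[of n j]
  unfolding of_nat_Suc by algebra

lemma delannoy_coeff_Suc_via_Suc_left:
  "(real j + 1)^2 * delannoy_coeff n (Suc j)
     = (real n - real j) * (real n + 1 - real j) * delannoy_coeff (Suc n) j"
  using delannoy_coeff_Suc[of j n] delannoy_coeff_Suc_left[of n j]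
  unfolding of_nat_Suc by algebra

lemma central_binomial_Suc_real:
  "(real j + 1) * real ((2 * Suc j) choose Suc j) = 2 * (2 * real j + 1) * real ((2 * j) choose j)"
proof -
  have 1: "((2 * Suc j) choose Suc j) = 2 * (Suc (2 * j) choose j)"
  proof -
    have "Suc (2 * j) choose j = Suc (2 * j) choose Suc j"
      using binomial_symmetric[of j "Suc (2 * j)"] by (simp add: Suc_diff_le del: binomial_Suc_Suc)
    moreover have "2 * Suc j choose Suc j = (Suc (2 * j) choose j) + (Suc (2 * j) choose Suc j)"
      using binomial_Suc_Suc[of "Suc (2 * j)" j] by simp
    ultimately show ?thesis by linarith
  qed
  have 2: "(real j + 1) * real (Suc (2 * j) choose j) = (2 * real j + 1) * real ((2 * j) choose j)"
  proof -
    have "Suc j + j = Suc (2 * j)" "j + j = 2 * j" "real j + real j + 1 = 2 * real j + 1" by simp_all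
    then show ?thesis using binomial_lower_step_real[of j j] by (simp only:)
  qed
  show ?thesis
    unfolding 1 of_nat_mult using 2 by (simp only: mult.left_commute[of _ 2] of_nat_numeral mult.assoc)
qed

lemma clausen_coeff_Suc_left:
  "(real n + 1 - real j) * clausen_coeff (Suc n) j = (real n + 1 + real j) * clausen_coeff n j"
  using delannoy_coeff_Suc_left[of n j] by (simp add: clausen_coeff_def)

lemma clausen_coeff_Suc_Suc:
  "(real j + 1)^3 * clausen_coeff (Suc n) (Suc j)
     = 2 * (2 * real j + 1) * (real n + real j + 1) * (real n + real j + 2) * clausen_coeff n j"
proof -
  have "(real j + 1)^3 * clausen_coeff (Suc n) (Suc j)
    = ((real j + 1)^2 * delannoy_coeff (Suc n) (Suc j)) * ((real j + 1) * real ((2 * Suc j) choose Suc j))"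
    by (simp add: clausen_coeff_def power2_eq_square power3_eq_cube)
  then show ?thesis
    unfolding delannoy_coeff_Suc_Suc central_binomial_Suc_real by (simp add: clausen_coeff_def)
qed

lemma clausen_coeff_Suc:
  "(real j + 1)^3 * clausen_coeff n (Suc j)
     = 2 * (2 * real j + 1) * (real n - real j) * (real n + real j + 1) * clausen_coeff n j"
proof -
  have "(real j + 1)^3 * clausen_coeff n (Suc j)
    = ((real j + 1)^2 * delannoy_coeff n (Suc j)) * ((real j + 1) * real ((2 * Suc j) choose Suc j))"
    by (simp add: clausen_coeff_def power2_eq_square power3_eq_cube)
  then show ?thesis
    unfolding delannoy_coeff_Suc central_binomial_Suc_real by (simp add: clausen_coeff_def)
qed

lemma clausen_coeff_Suc_via_Suc_left:
  "(real j + 1)^3 * clausen_coeff n (Suc j)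
     = 2 * (2 * real j + 1) * (real n - real j) * (real n + 1 - real j) * clausen_coeff (Suc n) j"
  using clausen_coeff_Suc[of j n] clausen_coeff_Suc_left[of n j]
  unfolding of_nat_Suc by algebra

section \<open>Recurrences\<close>

lemma sum_atMost_extend:
  fixes f :: "nat \<Rightarrow> 'a::comm_monoid_add"
  assumes "\<And>j. n < j \<Longrightarrow> f j = 0" "n \<le> N"
  shows "(\<Sum>j\<le>n. f j) = (\<Sum>j\<le>N. f j)"
  using assms by (intro sum.mono_neutral_left) auto

text \<open>Turns a coefficient recurrence that relates degree \<open>j + 1\<close> to degree \<open>j\<close> into one between sums: the
  degree shift becomes multiplication by \<open>x\<close>.\<close>
lemma sum_powers_shift:
  fixes u v w :: "nat \<Rightarrow> real"
  assumes "u 0 = v 0" "\<And>j. u (Suc j) = v (Suc j) + w j"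
  shows "(\<Sum>j\<le>Suc N. u j * x ^ j) = (\<Sum>j\<le>Suc N. v j * x ^ j) + x * (\<Sum>j\<le>N. w j * x ^ j)"
  by (simp add: sum.atMost_Suc_shift assms algebra_simps sum.distrib sum_distrib_left
      del: sum.atMost_Suc)

lemma delannoy_coeff_rec:
  "(real n + 2) * delannoy_coeff (Suc (Suc n)) (Suc j)
     = (2 * real n + 3) * delannoy_coeff (Suc n) (Suc j) - (real n + 1) * delannoy_coeff n (Suc j)
       + 2 * (2 * real n + 3) * delannoy_coeff (Suc n) j"
proof -
  have "(real j + 1)^2 * ((real n + 2) * delannoy_coeff (Suc (Suc n)) (Suc j)) =
    (real n + 2) * ((real j + 1)^2 * delannoy_coeff (Suc (Suc n)) (Suc j))" by simp
  also have "\<dots> = (2 * real n + 3) * ((real j + 1)^2 * delannoy_coeff (Suc n) (Suc j))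
     - (real n + 1) * ((real j + 1)^2 * delannoy_coeff n (Suc j))
       + (real j + 1)^2 * (2 * (2 * real n + 3) * delannoy_coeff (Suc n) j)"
    unfolding delannoy_coeff_Suc_Suc[of j "Suc n"] delannoy_coeff_Suc_via_Suc_left[of j n] delannoy_coeff_Suc[of j "Suc n"]
    by (simp add: algebra_simps power2_eq_square)
  also have "\<dots> = (real j + 1)^2 * ((2 * real n + 3) * delannoy_coeff (Suc n) (Suc j) - (real n + 1) * delannoy_coeff n (Suc j)
       + 2 * (2 * real n + 3) * delannoy_coeff (Suc n) j)"
    by (simp add: algebra_simps)
  finally show ?thesis by (subst (asm) mult_cancel_left) (simp add: add_eq_0_iff)
qed

lemma clausen_coeff_rec:
  "(real n + 2)^2 * clausen_coeff (Suc (Suc n)) (Suc j)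
     = (2 * real n + 3) * (2 * real (Suc j) + 1) * clausen_coeff (Suc n) (Suc j)
       + (real n + 1)^2 * clausen_coeff n (Suc j)
       + 4 * (2 * real n + 3) * (2 * real j + 1) * clausen_coeff (Suc n) j"
proof -
  have "(real j + 1)^3 * ((real n + 2)^2 * clausen_coeff (Suc (Suc n)) (Suc j)) =
    (real n + 2)^2 * ((real j + 1)^3 * clausen_coeff (Suc (Suc n)) (Suc j))" by simp
  also have "\<dots> = (2 * real n + 3) * (2 * real (Suc j) + 1) * ((real j + 1)^3 * clausen_coeff (Suc n) (Suc j))
     + (real n + 1)^2 * ((real j + 1)^3 * clausen_coeff n (Suc j))
       + (real j + 1)^3 * (4 * (2 * real n + 3) * (2 * real j + 1) * clausen_coeff (Suc n) j)"
    unfolding clausen_coeff_Suc_Suc[of j "Suc n"] clausen_coeff_Suc_via_Suc_left[of j n] clausen_coeff_Suc[of j "Suc n"]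
    by (simp add: algebra_simps power2_eq_square power3_eq_cube)
  also have "\<dots> = (real j + 1)^3 * ((2 * real n + 3) * (2 * real (Suc j) + 1) * clausen_coeff (Suc n) (Suc j)
       + (real n + 1)^2 * clausen_coeff n (Suc j)
       + 4 * (2 * real n + 3) * (2 * real j + 1) * clausen_coeff (Suc n) j)"
    by (simp add: algebra_simps)
  finally show ?thesis by (subst (asm) mult_cancel_left) (simp add: add_eq_0_iff)
qed

lemma delannoy_poly_extend:
  "n \<le> N \<Longrightarrow> delannoy_poly n x = (\<Sum>j\<le>N. delannoy_coeff n j * x ^ j)"
  unfolding delannoy_poly_def by (rule sum_atMost_extend) (auto simp: delannoy_coeff_eq_0)

text \<open>This is Bonnet's recurrence for the Legendre polynomials, read off coefficientwise.\<close>
lemma delannoy_poly_rec: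
  "(real n + 2) * delannoy_poly (Suc (Suc n)) x
     = (2 * real n + 3) * (2 * x + 1) * delannoy_poly (Suc n) x - (real n + 1) * delannoy_poly n x"
proof -
  have "(\<Sum>j\<le>Suc (Suc n). (real n + 2) * delannoy_coeff (Suc (Suc n)) j * x ^ j)
     = (\<Sum>j\<le>Suc (Suc n). ((2 * real n + 3) * delannoy_coeff (Suc n) j
                              - (real n + 1) * delannoy_coeff n j) * x ^ j)
       + x * (\<Sum>j\<le>Suc n. (2 * (2 * real n + 3) * delannoy_coeff (Suc n) j) * x ^ j)"
    by (rule sum_powers_shift) (use delannoy_coeff_rec in auto)
  then have "(real n + 2) * (\<Sum>j\<le>Suc (Suc n). delannoy_coeff (Suc (Suc n)) j * x ^ j)
     = (2 * real n + 3) * (\<Sum>j\<le>Suc (Suc n). delannoy_coeff (Suc n) j * x ^ j)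
       - (real n + 1) * (\<Sum>j\<le>Suc (Suc n). delannoy_coeff n j * x ^ j)
       + x * (2 * (2 * real n + 3) * (\<Sum>j\<le>Suc n. delannoy_coeff (Suc n) j * x ^ j))"
    by (simp only: left_diff_distrib sum_subtractf mult.assoc sum_distrib_left)
  then show ?thesis
    by (simp only: delannoy_poly_extend[symmetric] le_refl le_SucI) (simp add: algebra_simps)
qed


lemma clausen_sum_extend:
  assumes "n \<le> N"
  shows "(\<Sum>j\<le>n. f j * clausen_coeff n j * y ^ j) = (\<Sum>j\<le>N. f j * clausen_coeff n j * y ^ j)"
  using assms by (intro sum_atMost_extend) (auto simp: clausen_coeff_eq_0)

lemma clausen_sum_extend_unweighted:
  "n \<le> N \<Longrightarrow> (\<Sum>j\<le>n. clausen_coeff n j * y ^ j) = (\<Sum>j\<le>N. clausen_coeff n j * y ^ j)"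
  using clausen_sum_extend[of n N "\<lambda>_. 1"] by simp

definition clausen_sum :: "nat \<Rightarrow> real \<Rightarrow> real" where
  "clausen_sum n y = (\<Sum>j\<le>n. clausen_coeff n j * y ^ j)"

text \<open>The companion sum for products of consecutive Delannoy polynomials. The factor \<open>n + j choose 2 * j\<close>
  contained in \<open>clausen_coeff n j\<close> is turned by the weight into its odd counterpart
  \<open>(2 * j + 1) * (n + j choose 2 * j + 1)\<close>.\<close>
definition clausen_mixed_sum :: "nat \<Rightarrow> real \<Rightarrow> real" where
  "clausen_mixed_sum n y = (\<Sum>j\<le>n. (real n - real j) * clausen_coeff n j * y ^ j)"

text \<open>Bonnet's recurrence multiplied by \<open>delannoy_poly (Suc n)\<close> gives a relation between a square and two
  consecutive products; this is its counterpart for the two Clausen sums. It holds term by term.\<close>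
lemma clausen_mixed_sum_rec:
  "clausen_mixed_sum (Suc (Suc n)) y
     = (2 * real n + 3) * clausen_sum (Suc n) y - clausen_mixed_sum (Suc n) y"
proof -
  have term_eq: "(real n + 2 - real j) * clausen_coeff (Suc (Suc n)) j
      = (2 * real n + 3) * clausen_coeff (Suc n) j - (real n + 1 - real j) * clausen_coeff (Suc n) j" for j
    using clausen_coeff_Suc_left[of "Suc n" j] by (simp add: algebra_simps)
  have "clausen_mixed_sum (Suc (Suc n)) y
      = (\<Sum>j\<le>Suc (Suc n). ((2 * real n + 3) * clausen_coeff (Suc n) j
          - (real n + 1 - real j) * clausen_coeff (Suc n) j) * y ^ j)"
    unfolding clausen_mixed_sum_def term_eq[symmetric]
    by (rule sum.cong) auto
  also have "\<dots> = (2 * real n + 3) * (\<Sum>j\<le>Suc (Suc n). clausen_coeff (Suc n) j * y ^ j)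
     - (\<Sum>j\<le>Suc (Suc n). (real n + 1 - real j) * clausen_coeff (Suc n) j * y ^ j)"
    by (simp only: left_diff_distrib sum_subtractf mult.assoc sum_distrib_left)
  also have "\<dots> = (2 * real n + 3) * clausen_sum (Suc n) y - clausen_mixed_sum (Suc n) y"
    unfolding clausen_sum_def clausen_mixed_sum_def
    using clausen_sum_extend_unweighted[of "Suc n" "Suc (Suc n)" y]
     clausen_sum_extend[of "Suc n" "Suc (Suc n)" "\<lambda>j. real n + 1 - real j" y]
    by (simp only: le_SucI le_refl of_nat_Suc) (simp add: add.commute)
  finally show ?thesis .
qed

text \<open>The counterpart of the square of Bonnet's recurrence, with \<open>1 + 4 * y\<close> in the role of \<open>(2 * x + 1)\<^sup>2\<close>.\<close>
lemma clausen_sum_rec: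
  "(real n + 2)^2 * clausen_sum (Suc (Suc n)) y
     = (2 * real n + 3)^2 * (1 + 4 * y) * clausen_sum (Suc n) y
       - 2 * (2 * real n + 3) * (1 + 4 * y) * clausen_mixed_sum (Suc n) y
       + (real n + 1)^2 * clausen_sum n y"
proof -
  let ?c = "2 * real n + 3"
  have split: "?c * (2 * real j + 1) * clausen_coeff (Suc n) j
      = ?c^2 * clausen_coeff (Suc n) j - 2 * ?c * ((real (Suc n) - real j) * clausen_coeff (Suc n) j)" for j
    by (simp add: algebra_simps power2_eq_square)
  have *: "(\<Sum>j\<le>N. (?c * (2 * real j + 1) * clausen_coeff (Suc n) j) * y ^ j)
      = ?c^2 * clausen_sum (Suc n) y - 2 * ?c * clausen_mixed_sum (Suc n) y"
    if "Suc n \<le> N" for N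
    unfolding split clausen_sum_def clausen_mixed_sum_def
      clausen_sum_extend_unweighted[OF that] clausen_sum_extend[OF that] sum_distrib_left sum_subtractf[symmetric]
    by (intro sum.cong refl) (simp add: algebra_simps)
  have "(\<Sum>j\<le>Suc (Suc n). (real n + 2)^2 * clausen_coeff (Suc (Suc n)) j * y ^ j)
     = (\<Sum>j\<le>Suc (Suc n). (?c * (2 * real j + 1) * clausen_coeff (Suc n) j
                              + (real n + 1)^2 * clausen_coeff n j) * y ^ j)
       + y * (\<Sum>j\<le>Suc n. (4 * ?c * (2 * real j + 1) * clausen_coeff (Suc n) j) * y ^ j)"
  proof (rule sum_powers_shift)
    show "(real n + 2)^2 * clausen_coeff (Suc (Suc n)) 0
      = ?c * (2 * real 0 + 1) * clausen_coeff (Suc n) 0 + (real n + 1)^2 * clausen_coeff n 0"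
      by (simp add: power2_eq_square algebra_simps)
  qed (rule clausen_coeff_rec)
  also have "\<dots> = (\<Sum>j\<le>Suc (Suc n). (?c * (2 * real j + 1) * clausen_coeff (Suc n) j) * y ^ j)
      + (real n + 1)^2 * (\<Sum>j\<le>Suc (Suc n). clausen_coeff n j * y ^ j)
      + 4 * y * (\<Sum>j\<le>Suc n. (?c * (2 * real j + 1) * clausen_coeff (Suc n) j) * y ^ j)"
    unfolding sum_distrib_left sum.distrib[symmetric]
    by (intro arg_cong2[where f = "(+)"] sum.cong refl) (simp_all add: algebra_simps)
  also have "(\<Sum>j\<le>Suc (Suc n). clausen_coeff n j * y ^ j) = clausen_sum n y"
    unfolding clausen_sum_def by (rule clausen_sum_extend_unweighted[symmetric]) simp
  finally have main: "(\<Sum>j\<le>Suc (Suc n). (real n + 2)^2 * clausen_coeff (Suc (Suc n)) j * y ^ j)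
     = (?c^2 * clausen_sum (Suc n) y - 2 * ?c * clausen_mixed_sum (Suc n) y)
      + (real n + 1)^2 * clausen_sum n y
      + 4 * y * (?c^2 * clausen_sum (Suc n) y - 2 * ?c * clausen_mixed_sum (Suc n) y)"
    unfolding *[OF le_SucI[OF le_refl]] *[OF le_refl] .
  have "(real n + 2)^2 * clausen_sum (Suc (Suc n)) y
     = (\<Sum>j\<le>Suc (Suc n). (real n + 2)^2 * clausen_coeff (Suc (Suc n)) j * y ^ j)"
    unfolding clausen_sum_def by (simp only: mult.assoc sum_distrib_left)
  then show ?thesis unfolding main by algebra
qed

section \<open>Clausen's formula for Delannoy polynomials\<close>

text \<open>Squares and consecutive products of Delannoy polynomials are, together, determined by Bonnet's
  recurrence, and the two Clausen sums obey the same system with the same initial values. The argument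
  \<open>x * (x + 1)\<close> is forced by \<open>(2 * x + 1)\<^sup>2 = 1 + 4 * (x * (x + 1))\<close>. The recurrence of
  each sum refers to the other, so the three identities have to be proved in one induction.\<close>
lemma delannoy_poly_quadratic:
  fixes x :: real
  defines "y \<equiv> x * (x + 1)"
  shows "delannoy_poly n x ^ 2 = clausen_sum n y
     \<and> delannoy_poly (Suc n) x ^ 2 = clausen_sum (Suc n) y
     \<and> (real n + 1) * (delannoy_poly (Suc n) x * delannoy_poly n x)
          = (2 * x + 1) * clausen_mixed_sum (Suc n) y"
proof (induction n)
  case 0
  have "delannoy_coeff (Suc 0) (Suc 0) = 2" "clausen_coeff (Suc 0) (Suc 0) = 4"
    by (simp_all add: delannoy_coeff_def clausen_coeff_def)
  then show ?case
    by (simp add: delannoy_poly_def clausen_sum_def clausen_mixed_sum_def y_def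
        power2_eq_square algebra_simps)
next
  case (Suc n)
  let ?P = "\<lambda>n. delannoy_poly n x" and ?c = "2 * real n + 3" and ?t = "2 * x + 1"
  have sq0: "?P n ^ 2 = clausen_sum n y" and sq1: "?P (Suc n) ^ 2 = clausen_sum (Suc n) y"
    and mix: "(real n + 1) * (?P (Suc n) * ?P n) = ?t * clausen_mixed_sum (Suc n) y"
    using Suc.IH by blast+
  have rec: "(real n + 2) * ?P (Suc (Suc n)) = ?c * ?t * ?P (Suc n) - (real n + 1) * ?P n"
    by (rule delannoy_poly_rec)
  have t2: "?t^2 = 1 + 4 * y"
    by (simp add: y_def power2_eq_square algebra_simps)
  have "(real n + 2) * (?P (Suc (Suc n)) * ?P (Suc n))
      = ?c * ?t * ?P (Suc n)^2 - (real n + 1) * (?P (Suc n) * ?P n)"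
    using rec by algebra
  also have "\<dots> = ?t * clausen_mixed_sum (Suc (Suc n)) y"
    unfolding sq1 mix clausen_mixed_sum_rec by algebra
  finally have mix': "(real n + 2) * (?P (Suc (Suc n)) * ?P (Suc n))
      = ?t * clausen_mixed_sum (Suc (Suc n)) y" .
  have "(real n + 2)^2 * ?P (Suc (Suc n))^2
      = ?c^2 * ?t^2 * ?P (Suc n)^2 - 2 * ?c * ?t * ((real n + 1) * (?P (Suc n) * ?P n))
        + (real n + 1)^2 * ?P n ^ 2"
    using rec by algebra
  also have "\<dots> = (real n + 2)^2 * clausen_sum (Suc (Suc n)) y"
    unfolding sq0 sq1 mix clausen_sum_rec t2[symmetric] by algebra
  finally have "?P (Suc (Suc n))^2 = clausen_sum (Suc (Suc n)) y"
    by (subst (asm) mult_cancel_left) (simp add: add_eq_0_iff)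
  then show ?case using sq1 mix' by (simp add: add.commute)
qed

lemma delannoy_eq_poly: "real (delannoy n) = delannoy_poly n 1"
  by (simp add: delannoy_def delannoy_poly_def delannoy_coeff_def atMost_atLeast0)

section \<open>Little Schroeder numbers in terms of Delannoy numbers\<close>

text \<open>Vandermonde's identity expands \<open>(n + k) choose k\<close> over \<open>i\<close>; after exchanging the sums, the one over \<open>k\<close> is a
  full row of Pascal's triangle. In this form Delannoy numbers can be compared with the Narayana-type sum
  that defines the little Schroeder numbers.\<close>
lemma delannoy_eq_sum_binomial_squares:
  "delannoy n = (\<Sum>i\<le>n. (n choose i)^2 * 2 ^ (n - i))"
proof -
  have expand: "(n + k) choose k = (\<Sum>i\<le>k. (n choose i) * (k choose i))" for k
    using vandermonde[of n k k] by (simp add: binomial_symmetric[symmetric])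
  have "delannoy n = (\<Sum>k\<le>n. \<Sum>i\<le>k. (n choose i) * ((n choose k) * (k choose i)))"
    by (simp add: delannoy_def expand sum_distrib_left atMost_atLeast0 mult_ac)
  also have "\<dots> = (\<Sum>k\<le>n. \<Sum>i\<le>n. (n choose i) * ((n choose k) * (k choose i)))"
    by (intro sum.cong refl sum_atMost_extend) auto
  also have "\<dots> = (\<Sum>i\<le>n. \<Sum>k\<le>n. (n choose i) * ((n choose k) * (k choose i)))"
    by (rule sum.swap)
  also have "\<dots> = (\<Sum>i\<le>n. (n choose i)^2 * 2 ^ (n - i))"
  proof (intro sum.cong refl)
    fix i assume "i \<in> {..n}"
    then have i: "i \<le> n" by simp
    have "(\<Sum>k\<le>n. (n choose k) * (k choose i)) = (\<Sum>k\<in>{i..n}. (n choose k) * (k choose i))"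
      by (rule sum.mono_neutral_right) auto
    also have "\<dots> = (\<Sum>k\<in>{i..n}. (n choose i) * ((n - i) choose (k - i)))"
      by (intro sum.cong refl) (simp add: choose_mult)
    also have "\<dots> = (n choose i) * (\<Sum>k\<le>n - i. (n - i) choose k)"
      unfolding sum_distrib_left
      by (rule sum.reindex_bij_witness[of _ "\<lambda>k. k + i" "\<lambda>k. k - i"]) (use i in auto)
    also have "(\<Sum>k\<le>n - i. (n - i) choose k) = 2 ^ (n - i)"
      by (rule choose_row_sum)
    finally show "(\<Sum>k\<le>n. (n choose i) * ((n choose k) * (k choose i))) = (n choose i)^2 * 2 ^ (n - i)"
      by (simp add: sum_distrib_left[symmetric] power2_eq_square)
  qed
  finally show ?thesis .
qed

lemma delannoy_eq_sum_binomial_squares_rev: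
  "delannoy n = (\<Sum>i\<le>n. (n choose i)^2 * 2 ^ i)"
  unfolding delannoy_eq_sum_binomial_squares
  by (rule sum.reindex_bij_witness[of _ "\<lambda>i. n - i" "\<lambda>i. n - i"])
     (auto simp: binomial_symmetric[symmetric])

lemma little_schroeder_reflect:
  "real n * little_schroeder n = (\<Sum>j<n. real (n choose j) * real (n choose Suc j) * 2 ^ j)"
proof (cases "n = 0")
  case False
  have "real n * little_schroeder n
      = (\<Sum>k=1..n. real (n choose k) * real (n choose (k - 1)) * 2 ^ (n - k))"
    using False by (simp add: little_schroeder_def sum_distrib_left)
  also have "\<dots> = (\<Sum>j<n. real (n choose j) * real (n choose Suc j) * 2 ^ j)"
  proof (rule sum.reindex_bij_witness[of _ "\<lambda>j. n - j" "\<lambda>k. n - k"])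
    fix k assume k: "k \<in> {1..n}"
    then have "n choose (n - k) = n choose k" "n choose Suc (n - k) = n choose (k - 1)"
      using binomial_symmetric[of k n] binomial_symmetric[of "k - 1" n] by (auto simp: Suc_diff_le)
    then show "real (n choose (n - k)) * real (n choose Suc (n - k)) * 2 ^ (n - k)
       = real (n choose k) * real (n choose (k - 1)) * 2 ^ (n - k)" by simp
  qed auto
  finally show ?thesis .
qed (simp add: little_schroeder_def)

text \<open>The summand is the termwise difference between the two sides of the relation
  \<open>4 * (n + 1) * s\<^sub>n = 3 * D\<^sub>n - D\<^sub>m\<close>, where \<open>m = n - 1\<close>. It does not vanish, but it telescopes, and the
  right-hand side is the antidifference.\<close>
lemma schroeder_telescope:
  fixes m :: nat
  defines "n \<equiv> Suc m"
  shows "(\<Sum>j\<le>N. 2 ^ j * (3 * real (n choose j)^2 - real (m choose j)^2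
            - 4 * (real n + 1) / real n * (real (n choose j) * real (n choose Suc j))))
       = - (2 ^ Suc N * (2 * real (m choose Suc N) * real (m choose N) + 3 * real (m choose N)^2))"
proof (induction N)
  case 0
  show ?case by (simp add: n_def field_simps power2_eq_square)
next
  case (Suc N)
  define a b c where "a = real (m choose Suc (Suc N))" and "b = real (m choose Suc N)"
    and "c = real (m choose N)"
  have ab: "real (n choose Suc (Suc N)) = a + b" and bc: "real (n choose Suc N) = b + c"
    by (simp_all add: n_def a_def b_def c_def)
  have "(real (Suc N) + 1) * (a + b) = real n * b" "(real N + 1) * (b + c) = real n * c"
    using binomial_absorb_real[of "Suc N" m] binomial_absorb_real[of N m] ab bc
    unfolding b_def c_def n_def by (simp_all del: binomial_Suc_Suc add: add.commute)
  then have "(real N + 2) * (a + b) = real n * b" "(real N + 1) * (b + c) = real n * c"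
    by (simp_all add: add.commute)
  \<comment> \<open>Writing the Narayana number \<open>(b + c) * (a + b) / n\<close> as \<open>b\<^sup>2 - a * c\<close> removes the division by \<open>n\<close>.\<close>
  then have "(real N + 1) * (real N + 2) * ((b + c) * (a + b)) = (real N + 1) * (real N + 2) * (real n * (b^2 - a * c))"
    by algebra
  then have prod: "(b + c) * (a + b) = real n * (b^2 - a * c)"
    by (subst (asm) mult_cancel_left) (simp add: add_eq_0_iff)
  have "real n \<noteq> 0" by (simp add: n_def)
  then have K: "4 * (real n + 1) / real n * ((b + c) * (a + b)) 
      = 4 * ((b + c) * (a + b)) + 4 * (b^2 - a * c)"
    unfolding prod by (simp add: field_simps)
  show ?case
    unfolding sum.atMost_Suc Suc.IH ab bc K
    unfolding a_def[symmetric] b_def[symmetric] c_def[symmetric] power_Suc by algebra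
qed

text \<open>The antidifference above, at \<open>N = m\<close>, cancels exactly against the top term \<open>j = n\<close> of the Delannoy sum,
  which the telescoping range leaves out.\<close>
lemma little_schroeder_delannoy:
  "4 * (real (Suc m) + 1) * little_schroeder (Suc m) = 3 * real (delannoy (Suc m)) - real (delannoy m)"
proof -
  let ?n = "Suc m"
  have "(\<Sum>j\<le>m. 2 ^ j * (3 * real (?n choose j)^2 - real (m choose j)^2
            - 4 * (real ?n + 1) / real ?n * (real (?n choose j) * real (?n choose Suc j))))
      = 3 * (\<Sum>j\<le>m. real (?n choose j)^2 * 2 ^ j) - (\<Sum>j\<le>m. real (m choose j)^2 * 2 ^ j)
          - 4 * (real ?n + 1) / real ?n * (\<Sum>j\<le>m. real (?n choose j) * real (?n choose Suc j) * 2 ^ j)"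
    unfolding sum_distrib_left sum_subtractf[symmetric]
    by (intro sum.cong refl) (simp only: right_diff_distrib mult_ac)
  moreover have "(\<Sum>j\<le>m. real (?n choose j)^2 * 2 ^ j) = real (delannoy ?n) - 2 ^ ?n"
    by (simp add: delannoy_eq_sum_binomial_squares_rev del: binomial_Suc_Suc)
  moreover have "(\<Sum>j\<le>m. real (m choose j)^2 * 2 ^ j) = real (delannoy m)"
    by (simp add: delannoy_eq_sum_binomial_squares_rev)
  moreover have "(\<Sum>j\<le>m. real (?n choose j) * real (?n choose Suc j) * 2 ^ j)
      = real ?n * little_schroeder ?n"
    unfolding little_schroeder_reflect lessThan_Suc_atMost ..
  moreover have top: "- (2 ^ ?n * (2 * real (m choose ?n) * real (m choose m) + 3 * real (m choose m)^2))
      = - (2 ^ ?n * 3 :: real)"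
    by (simp add: binomial_eq_0)
  ultimately have "- (2 ^ ?n * 3)
      = 3 * (real (delannoy ?n) - 2 ^ ?n) - real (delannoy m)
        - 4 * (real ?n + 1) / real ?n * (real ?n * little_schroeder ?n)"
    unfolding schroeder_telescope top by (simp only:)
  then show ?thesis by (simp del: of_nat_Suc)
qed

section \<open>Evaluation of the alternating sums\<close>

lemma alternating_sum_eq:
  fixes f g :: "nat \<Rightarrow> 'a::comm_ring_1"
  assumes "f 0 = 0" "\<And>k. f (Suc k) + f k = g (Suc k)"
  shows "(\<Sum>k=1..n. (-1) ^ (n - k) * g k) = f n"
proof (induction n)
  case (Suc n)
  have "(\<Sum>k=1..n. (-1) ^ (Suc n - k) * g k) = - (\<Sum>k=1..n. (-1) ^ (n - k) * g k)"
    unfolding sum_negf[symmetric] by (intro sum.cong refl) (simp add: Suc_diff_le)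
  then show ?case
    using assms(2)[of n] Suc.IH by (simp add: algebra_simps)
qed (use assms in simp)

lemma delannoy_square: "real (delannoy n)^2 = clausen_sum n 2"
  using delannoy_poly_quadratic[of n 1] by (simp add: delannoy_eq_poly)

lemma delannoy_consecutive:
  "(real n + 1) * (real (delannoy (Suc n)) * real (delannoy n)) = 3 * clausen_mixed_sum (Suc n) 2"
  using delannoy_poly_quadratic[of n 1] by (simp add: delannoy_eq_poly)

text \<open>For each \<open>j\<close> the alternating sum over \<open>k\<close> telescopes: \<open>(n - j) * (n + j + 1) * clausen_coeff n j\<close> and
  the same expression at \<open>n - 1\<close> add up to \<open>2 * n * (n - j) * clausen_coeff n j\<close>, because
  \<open>(n + j) * clausen_coeff (n - 1) j = (n - j) * clausen_coeff n j\<close>.\<close>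
lemma alternating_delannoy_sum:
  "(\<Sum>k=1..n. (-1) ^ (n - k) * ((real k)^2 * real (delannoy k) * real (delannoy (k - 1))))
     = 3 / 2 * (\<Sum>j\<le>n. (real n - real j) * (real n + real j + 1) * clausen_coeff n j * 2 ^ j)"
proof (rule alternating_sum_eq)
  fix k
  let ?h = "\<lambda>n j. (real n - real j) * (real n + real j + 1)"
  have step: "?h (Suc k) j * clausen_coeff (Suc k) j + ?h k j * clausen_coeff k j
     = 2 * (real k + 1) * ((real (Suc k) - real j) * clausen_coeff (Suc k) j)" for j
    using clausen_coeff_Suc_left[of k j] unfolding of_nat_Suc by algebra
  have "(\<Sum>j\<le>k. ?h k j * clausen_coeff k j * 2 ^ j) = (\<Sum>j\<le>Suc k. ?h k j * clausen_coeff k j * 2 ^ j)"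
    by (rule clausen_sum_extend) simp
  then have "(\<Sum>j\<le>Suc k. ?h (Suc k) j * clausen_coeff (Suc k) j * 2 ^ j)
      + (\<Sum>j\<le>k. ?h k j * clausen_coeff k j * 2 ^ j)
      = (\<Sum>j\<le>Suc k. (?h (Suc k) j * clausen_coeff (Suc k) j + ?h k j * clausen_coeff k j) * 2 ^ j)"
    by (simp only: sum.distrib distrib_right)
  also have "\<dots> = 2 * (real k + 1) * clausen_mixed_sum (Suc k) 2"
    unfolding step clausen_mixed_sum_def sum_distrib_left by (simp only: mult.assoc)
  finally have "3 / 2 * (\<Sum>j\<le>Suc k. ?h (Suc k) j * clausen_coeff (Suc k) j * 2 ^ j)
      + 3 / 2 * (\<Sum>j\<le>k. ?h k j * clausen_coeff k j * 2 ^ j)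
      = (real k + 1) * (3 * clausen_mixed_sum (Suc k) 2)"
    by (simp only: distrib_left[symmetric])
  then show "3 / 2 * (\<Sum>j\<le>Suc k. ?h (Suc k) j * clausen_coeff (Suc k) j * 2 ^ j)
      + 3 / 2 * (\<Sum>j\<le>k. ?h k j * clausen_coeff k j * 2 ^ j)
      = (real (Suc k))^2 * real (delannoy (Suc k)) * real (delannoy (Suc k - 1))"
    unfolding delannoy_consecutive[symmetric] by (simp add: power2_eq_square add.commute mult.assoc)
qed simp

text \<open>Eliminating the Schroeder number leaves \<open>9 * clausen_mixed_sum\<close> minus a multiple of \<open>clausen_sum\<close>. Since
  \<open>9 = 1 + 4 * 2\<close>, this splits into a part whose coefficients carry a factor \<open>j\<close> and a multiple of
  \<open>4 * 2\<close>; lowering the index in the first part makes both parts multiples of \<open>clausen_coeff m i\<close> and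
  brings out the common factor 4.\<close>
lemma schroeder_delannoy_product:
  "(real m + 1) * (real m + 2) * (little_schroeder (Suc m) * real (delannoy m))
     = (\<Sum>i\<le>m. clausen_coeff m i * (real m + real i + 1)
          * ((2 * real i + 1) * (real m - real i) / (real i + 1)^2 + 2) * 2 ^ i)"
proof -
  let ?D = "real (delannoy m)" and ?D' = "real (delannoy (Suc m))"
  have "4 * ((real m + 1) * (real m + 2) * (little_schroeder (Suc m) * ?D))
      = (real m + 1) * (4 * (real (Suc m) + 1) * little_schroeder (Suc m)) * ?D" by simp
  also have "\<dots> = 3 * ((real m + 1) * (?D' * ?D)) - (real m + 1) * ?D^2"
    unfolding little_schroeder_delannoy by (simp add: algebra_simps power2_eq_square)
  also have "\<dots> = 9 * clausen_mixed_sum (Suc m) 2 - (real m + 1) * clausen_sum m 2"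
    unfolding delannoy_consecutive delannoy_square by simp
  also have "clausen_mixed_sum (Suc m) 2 = (\<Sum>j\<le>Suc m. (real m + 1 + real j) * clausen_coeff m j * 2 ^ j)"
    unfolding clausen_mixed_sum_def clausen_coeff_Suc_left[symmetric] by (simp add: add.commute)
  also have "\<dots> = (\<Sum>j\<le>m. (real m + 1 + real j) * clausen_coeff m j * 2 ^ j)"
    by (rule clausen_sum_extend[symmetric]) simp
  also have "9 * \<dots> - (real m + 1) * clausen_sum m 2
      = (\<Sum>j\<le>m. real j * clausen_coeff m j * 2 ^ j)
        + 8 * (\<Sum>j\<le>m. (real m + 1 + real j) * clausen_coeff m j * 2 ^ j)"
    unfolding clausen_sum_def sum_distrib_left sum_subtractf[symmetric] sum.distrib[symmetric]
    by (intro sum.cong refl) (simp add: algebra_simps)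
  also have "(\<Sum>j\<le>m. real j * clausen_coeff m j * 2 ^ j)
      = (\<Sum>j\<le>Suc m. real j * clausen_coeff m j * 2 ^ j)"
    by (rule clausen_sum_extend) simp
  also have "\<dots> = (\<Sum>i\<le>m. real (Suc i) * clausen_coeff m (Suc i) * 2 ^ Suc i)"
    by (simp add: sum.atMost_Suc_shift del: sum.atMost_Suc)
  also have "\<dots> = (\<Sum>i\<le>m. 4 * ((2 * real i + 1) * (real m - real i) * (real m + real i + 1)
      * clausen_coeff m i / (real i + 1)^2 * 2 ^ i))"
  proof (intro sum.cong refl)
    fix i
    have "real (Suc i) * clausen_coeff m (Suc i)
      = ((real i + 1)^3 * clausen_coeff m (Suc i)) / (real i + 1)^2"
      by (simp add: power2_eq_square power3_eq_cube add_eq_0_iff)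
    also have "\<dots> = 2 * ((2 * real i + 1) * (real m - real i) * (real m + real i + 1)
      * clausen_coeff m i / (real i + 1)^2)"
      unfolding clausen_coeff_Suc by simp
    finally show "real (Suc i) * clausen_coeff m (Suc i) * 2 ^ Suc i
      = 4 * ((2 * real i + 1) * (real m - real i) * (real m + real i + 1)
      * clausen_coeff m i / (real i + 1)^2 * 2 ^ i)" by simp
  qed
  also have "\<dots> + 8 * (\<Sum>j\<le>m. (real m + 1 + real j) * clausen_coeff m j * 2 ^ j)
     = 4 * (\<Sum>i\<le>m. clausen_coeff m i * (real m + real i + 1)
          * ((2 * real i + 1) * (real m - real i) / (real i + 1)^2 + 2) * 2 ^ i)"
    unfolding sum_distrib_left sum.distrib[symmetric]
    by (intro sum.cong refl) (simp add: algebra_simps)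
  finally show ?thesis by simp
qed

text \<open>Again each coefficient telescopes in \<open>k\<close>. This is where the polynomial \<open>4 * k\<^sup>2 + 2 * k - 1\<close> comes from: it
  is, up to the denominator \<open>k * (k + 1)\<close>, the factor that remains when two consecutive values of the right-hand
  side are added, and it does not depend on \<open>i\<close>.\<close>
lemma alternating_schroeder_sum:
  "(\<Sum>k=1..n. (-1) ^ (n - k) * ((4 * (real k)^2 + 2 * real k - 1) * real (delannoy (k - 1)) * little_schroeder k))
     = (\<Sum>i\<le>n. delannoy_coeff n (Suc i) * real ((2 * i) choose i)
          * ((4 * real i + 2) + 1 / (real n + 1)) * 2 ^ i)"
proof (rule alternating_sum_eq)
  show "(\<Sum>i\<le>0. delannoy_coeff 0 (Suc i) * real ((2 * i) choose i)
          * ((4 * real i + 2) + 1 / (real 0 + 1)) * 2 ^ i) = 0"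
    by (simp add: delannoy_coeff_eq_0)
next
  fix m
  let ?f = "\<lambda>n i. delannoy_coeff n (Suc i) * real ((2 * i) choose i)
          * ((4 * real i + 2) + 1 / (real n + 1)) * 2 ^ i"
  let ?g = "\<lambda>i. clausen_coeff m i * (real m + real i + 1)
          * ((2 * real i + 1) * (real m - real i) / (real i + 1)^2 + 2) * 2 ^ i"
  let ?q = "4 * (real (Suc m))^2 + 2 * real (Suc m) - 1"
  have step: "?f (Suc m) i + ?f m i = ?q / ((real m + 1) * (real m + 2)) * ?g i" for i
  proof -
    have nz: "real m + 1 \<noteq> 0" "real m + 2 \<noteq> 0" "real i + 1 \<noteq> 0" by simp_all
    have up: "delannoy_coeff (Suc m) (Suc i)
      = (real m + real i + 1) * (real m + real i + 2) * delannoy_coeff m i / (real i + 1)^2"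
      unfolding delannoy_coeff_Suc_Suc[symmetric] using nz by simp
    have same: "delannoy_coeff m (Suc i)
      = (real m - real i) * (real m + real i + 1) * delannoy_coeff m i / (real i + 1)^2"
      unfolding delannoy_coeff_Suc[symmetric] using nz by simp
    let ?u = "delannoy_coeff m i * real ((2 * i) choose i) * (real m + real i + 1) * 2 ^ i / (real i + 1)^2"
    have "?f (Suc m) i + ?f m i
       = ?u * ((real m + real i + 2) * ((4 * real i + 2) + 1 / (real m + 2))
          + (real m - real i) * ((4 * real i + 2) + 1 / (real m + 1)))"
    proof -
      have eq: "real (Suc m) + 1 = real m + 2" by simp
      show ?thesis
        unfolding up same divide_inverse eq by (simp add: algebra_simps)
    qed
    also have "(real m + real i + 2) * ((4 * real i + 2) + 1 / (real m + 2))
          + (real m - real i) * ((4 * real i + 2) + 1 / (real m + 1))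
        = ?q / ((real m + 1) * (real m + 2)) * ((2 * real i + 1) * (real m - real i) + 2 * (real i + 1)^2)"
      using nz by (simp add: divide_simps) algebra
    also have "?u * \<dots> = ?q / ((real m + 1) * (real m + 2)) * ?g i"
      using nz by (simp add: clausen_coeff_def divide_simps)
    finally show ?thesis .
  qed
  have "(\<Sum>i\<le>m. ?f m i) = (\<Sum>i\<le>Suc m. ?f m i)"
    by (rule sum_atMost_extend) (auto simp: delannoy_coeff_eq_0)
  then have "(\<Sum>i\<le>Suc m. ?f (Suc m) i) + (\<Sum>i\<le>m. ?f m i)
      = (\<Sum>i\<le>Suc m. ?q / ((real m + 1) * (real m + 2)) * ?g i)"
    by (simp only: step flip: sum.distrib)
  also have "\<dots> = ?q / ((real m + 1) * (real m + 2)) * (\<Sum>i\<le>Suc m. ?g i)"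
    by (simp only: sum_distrib_left)
  also have "(\<Sum>i\<le>Suc m. ?g i) = (\<Sum>i\<le>m. ?g i)"
    by (simp add: clausen_coeff_eq_0)
  also have "?q / ((real m + 1) * (real m + 2)) * (\<Sum>i\<le>m. ?g i)
      = ?q * real (delannoy (Suc m - 1)) * little_schroeder (Suc m)"
    unfolding schroeder_delannoy_product[symmetric] by (simp add: add_eq_0_iff)
  finally show "(\<Sum>i\<le>Suc m. ?f (Suc m) i) + (\<Sum>i\<le>m. ?f m i)
      = ?q * real (delannoy (Suc m - 1)) * little_schroeder (Suc m)" .
qed

section \<open>Integrality and parity\<close>

text \<open>Both closed forms have this shape, so only the term of index 0 matters for the parity.\<close>
lemma sum_powers_of_two_odd:
  fixes c :: "nat \<Rightarrow> nat"
  assumes "odd (c 0)"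
  shows "odd (\<Sum>i\<le>m. 2 ^ i * c i)"
proof (induction m)
  case (Suc m)
  then show ?case by simp
qed (use assms in simp)

lemma positive_odd_integer_of_nat:
  "odd k \<Longrightarrow> positive_odd_integer (real k)"
  unfolding positive_odd_integer_def
  by (rule exI[of _ "int k"]) (use odd_pos in auto)

lemma delannoy_coeff_consecutive_product:
  "(real m + 1) * (real m + 2) * (real (m choose j) * real ((m + 2 + j) choose j))
     = (real (Suc m) - real j) * (real (Suc m) + real j + 1) * delannoy_coeff (Suc m) j"
proof -
  have 1: "(real m + 1) * real (m choose j) = (real (Suc m) - real j) * real (Suc m choose j)"
    using binomial_step_real[of j "Suc m"] binomial_absorb_real[of j m]
    by (simp del: binomial_Suc_Suc)
  have 2: "(real m + 2) * real ((m + 2 + j) choose j) = (real (Suc m) + real j + 1) * real ((Suc m + j) choose j)"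
    using binomial_lower_step_real[of "Suc m" j] by (simp del: binomial_Suc_Suc add: add.commute)
  have "(real m + 1) * (real m + 2) * (real (m choose j) * real ((m + 2 + j) choose j))
    = ((real m + 1) * real (m choose j)) * ((real m + 2) * real ((m + 2 + j) choose j))" by simp
  then show ?thesis unfolding 1 2 by (simp add: delannoy_coeff_def)
qed

text \<open>The factor \<open>n * (n + 1)\<close> of the alternating sum is absorbed into the binomial coefficients, which
  leaves a sum of integers.\<close>
lemma first_sum_closed_form:
  fixes m :: nat
  defines "n \<equiv> Suc m"
  shows "2 / (3 * real n * (real n + 1)) *
      (\<Sum>k=1..n. (-1) ^ (n - k) * (real k)^2 * real (delannoy k) * real (delannoy (k - 1)))
    = real (\<Sum>j\<le>m. 2 ^ j * ((m choose j) * ((m + 2 + j) choose j) * ((2 * j) choose j)))"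
proof -
  have "(\<Sum>k=1..n. (-1) ^ (n - k) * (real k)^2 * real (delannoy k) * real (delannoy (k - 1)))
     = 3 / 2 * (\<Sum>j\<le>n. (real n - real j) * (real n + real j + 1) * clausen_coeff n j * 2 ^ j)"
    using alternating_delannoy_sum[of n] by (simp only: mult.assoc)
  also have "(\<Sum>j\<le>n. (real n - real j) * (real n + real j + 1) * clausen_coeff n j * 2 ^ j)
      = (\<Sum>j\<le>m. (real n - real j) * (real n + real j + 1) * clausen_coeff n j * 2 ^ j)"
    by (simp add: n_def)
  also have "\<dots> = real n * (real n + 1) * real (\<Sum>j\<le>m. 2 ^ j * ((m choose j) * ((m + 2 + j) choose j) * ((2 * j) choose j)))"
    unfolding of_nat_sum sum_distrib_left
  proof (intro sum.cong refl)
    fix j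
    have "(real n - real j) * (real n + real j + 1) * clausen_coeff n j * 2 ^ j
      = ((real n - real j) * (real n + real j + 1) * delannoy_coeff n j) * real ((2 * j) choose j) * 2 ^ j"
      by (simp add: clausen_coeff_def)
    also have "\<dots> = ((real m + 1) * (real m + 2) * (real (m choose j) * real ((m + 2 + j) choose j)))
        * real ((2 * j) choose j) * 2 ^ j"
      unfolding n_def delannoy_coeff_consecutive_product ..
    also have "\<dots> = real n * (real n + 1) * real (2 ^ j * ((m choose j) * ((m + 2 + j) choose j) * ((2 * j) choose j)))"
      by (simp add: n_def add.commute)
    finally show "(real n - real j) * (real n + real j + 1) * clausen_coeff n j * 2 ^ j
      = real n * (real n + 1) * real (2 ^ j * ((m choose j) * ((m + 2 + j) choose j) * ((2 * j) choose j)))" .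
  qed
  finally have closed: "(\<Sum>k=1..n. (-1) ^ (n - k) * (real k)^2 * real (delannoy k) * real (delannoy (k - 1)))
     = 3 / 2 * (real n * (real n + 1) * real (\<Sum>j\<le>m. 2 ^ j * ((m choose j) * ((m + 2 + j) choose j) * ((2 * j) choose j))))" .
  have cancel: "2 / (3 * a * (a + 1)) * (3 / 2 * (a * (a + 1) * t)) = t" if "a > 0" for a t :: real
    using that by (simp add: divide_simps)
  show ?thesis unfolding closed by (rule cancel) (simp add: n_def)
qed

text \<open>The integrality of \<open>j * (n choose j) * (n + j choose j) / (n * (n + 1))\<close>, with \<open>n = m + 1\<close> and
  \<open>j = i + 1\<close>. Call this quotient \<open>q\<close>. The two integers whose difference is \<open>X\<close> are \<open>(n + 1) * q\<close> and
  \<open>n * q\<close>.\<close>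
lemma delannoy_coeff_quotient:
  fixes m i :: nat
  defines "X \<equiv> (m choose i) * ((m + 2 + i) choose Suc i) - (Suc m choose Suc i) * ((m + 2 + i) choose i)"
  shows "real (Suc i) * delannoy_coeff (Suc m) (Suc i) = (real m + 1) * (real m + 2) * real X"
proof -
  let ?d = "delannoy_coeff (Suc m) (Suc i)"
  have shift: "real ((m + 2 + i) choose Suc i) * (real i + 1) = (real m + 2) * real ((m + 2 + i) choose i)"
    using binomial_step_real[of i "m + 2 + i"] by (simp add: mult.commute)
  have 1: "(real m + 1) * (real (m choose i) * real ((m + 2 + i) choose Suc i)) = (real i + 1) * ?d"
    unfolding delannoy_coeff_def using binomial_absorb_real[of i m]
    by (simp del: binomial_Suc_Suc)
  have 2: "(real m + 2) * (real (Suc m choose Suc i) * real ((m + 2 + i) choose i)) = (real i + 1) * ?d"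
    unfolding delannoy_coeff_def using shift
    by (simp del: binomial_Suc_Suc add: mult.commute)
  let ?a = "real (m choose i) * real ((m + 2 + i) choose Suc i)"
    and ?b = "real (Suc m choose Suc i) * real ((m + 2 + i) choose i)"
  have diff: "(real m + 1) * (real m + 2) * (?a - ?b) = (real i + 1) * ?d"
    using 1 2 by algebra
  have "0 \<le> (real i + 1) * ?d" by (simp add: delannoy_coeff_def)
  moreover have "0 < (real m + 1) * (real m + 2)" by simp
  ultimately have "0 \<le> ?a - ?b"
    unfolding diff[symmetric] by (metis linorder_not_le mult_pos_neg)
  then have "?b \<le> ?a" by (simp only: diff_ge_0_iff_ge)
  then have "(Suc m choose Suc i) * ((m + 2 + i) choose i) \<le> (m choose i) * ((m + 2 + i) choose Suc i)"
    by (simp only: of_nat_mult[symmetric] of_nat_le_iff)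
  then have "real X = ?a - ?b"
    unfolding X_def by (simp only: of_nat_diff of_nat_mult)
  then show ?thesis using diff by (simp add: add.commute)
qed

text \<open>The Catalan numbers, as a difference so that they are natural numbers by construction.\<close>
definition catalan :: "nat \<Rightarrow> nat" where
  "catalan i = ((2 * i) choose i) - ((2 * i) choose Suc i)"

lemma catalan_real: "(real i + 1) * real (catalan i) = real ((2 * i) choose i)"
proof -
  have "((2 * i) choose Suc i) \<le> ((2 * i) choose i)"
    by (rule binomial_maximum')
  moreover have "(real i + 1) * real ((2 * i) choose Suc i) = real i * real ((2 * i) choose i)"
    using binomial_step_real[of i "2 * i"] by simp
  ultimately show ?thesis
    by (simp add: catalan_def of_nat_diff algebra_simps)
qed

text \<open>In the term of index \<open>i\<close> the summand \<open>4 * i + 2\<close> combines with the central binomial coefficient to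
  the next one, and its cofactor is divisible by \<open>n\<close>. The summand \<open>1 / (n + 1)\<close> needs both
  \<open>n\<close> and \<open>n + 1\<close> cancelled at once; for this one factor \<open>i + 1\<close> is moved from the central binomial
  coefficient, which leaves a Catalan number, to \<open>delannoy_coeff n (Suc i)\<close>.\<close>
lemma second_sum_closed_form:
  fixes m :: nat
  defines "n \<equiv> Suc m"
    and "X \<equiv> \<lambda>i. (m choose i) * ((m + 2 + i) choose Suc i) - (Suc m choose Suc i) * ((m + 2 + i) choose i)"
  shows "1 / real n * (\<Sum>k=1..n. (-1) ^ (n - k) * (4 * (real k)^2 + 2 * real k - 1)
                * real (delannoy (k - 1)) * little_schroeder k)
    = real (\<Sum>i\<le>m. 2 ^ i * ((m choose i) * ((m + 2 + i) choose Suc i) * ((2 * Suc i) choose Suc i)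
                               + catalan i * X i))"
proof -
  have "(\<Sum>k=1..n. (-1) ^ (n - k) * (4 * (real k)^2 + 2 * real k - 1)
                * real (delannoy (k - 1)) * little_schroeder k)
     = (\<Sum>i\<le>n. delannoy_coeff n (Suc i) * real ((2 * i) choose i)
          * ((4 * real i + 2) + 1 / (real n + 1)) * 2 ^ i)"
    using alternating_schroeder_sum[of n] by (simp only: mult.assoc)
  also have "\<dots> = (\<Sum>i\<le>m. delannoy_coeff n (Suc i) * real ((2 * i) choose i)
          * ((4 * real i + 2) + 1 / (real n + 1)) * 2 ^ i)"
    by (simp add: n_def delannoy_coeff_eq_0)
  also have "\<dots> = real n * real (\<Sum>i\<le>m. 2 ^ i * ((m choose i) * ((m + 2 + i) choose Suc i) * ((2 * Suc i) choose Suc i)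
                               + catalan i * X i))"
    unfolding of_nat_sum sum_distrib_left
  proof (intro sum.cong refl)
    fix i
    let ?d = "delannoy_coeff n (Suc i)" and ?B = "real ((2 * i) choose i)"
    have "real n * (real (m choose i) * real ((m + 2 + i) choose Suc i)) = (real i + 1) * ?d"
      unfolding n_def delannoy_coeff_def using binomial_absorb_real[of i m]
      by (simp del: binomial_Suc_Suc add: add.commute)
    then have "real n * (real (m choose i) * real ((m + 2 + i) choose Suc i)) * real ((2 * Suc i) choose Suc i)
       = ?d * ((real i + 1) * real ((2 * Suc i) choose Suc i))"
      by simp
    then have main: "real n * (real (m choose i) * real ((m + 2 + i) choose Suc i)) * real ((2 * Suc i) choose Suc i)
       = ?d * ?B * (4 * real i + 2)"
      unfolding central_binomial_Suc_real by (simp add: algebra_simps)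
    have "?d * ?B = (real (Suc i) * ?d) * real (catalan i)"
      unfolding catalan_real[symmetric] by simp
    also have "\<dots> = (real m + 1) * (real m + 2) * real (X i) * real (catalan i)"
      unfolding n_def delannoy_coeff_quotient X_def ..
    also have "\<dots> = real n * (real n + 1) * (real (catalan i) * real (X i))"
      by (simp add: n_def add.commute)
    finally have rest: "real n * (real (catalan i) * real (X i)) = ?d * ?B / (real n + 1)"
      by (simp add: field_simps)
    have "real n * real (2 ^ i * ((m choose i) * ((m + 2 + i) choose Suc i) * ((2 * Suc i) choose Suc i)
                               + catalan i * X i))
      = (real n * (real (m choose i) * real ((m + 2 + i) choose Suc i)) * real ((2 * Suc i) choose Suc i)
          + real n * (real (catalan i) * real (X i))) * 2 ^ i"
      by (simp only: of_nat_add of_nat_mult of_nat_power of_nat_numeral distrib_left distrib_right mult_ac)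
    also have "\<dots> = ?d * ?B * ((4 * real i + 2) + 1 / (real n + 1)) * 2 ^ i"
      unfolding main rest by (simp add: distrib_left)
    finally show "?d * ?B * ((4 * real i + 2) + 1 / (real n + 1)) * 2 ^ i
      = real n * real (2 ^ i * ((m choose i) * ((m + 2 + i) choose Suc i) * ((2 * Suc i) choose Suc i)
                               + catalan i * X i))" ..
  qed
  finally show ?thesis by (simp add: n_def)
qed

theorem theorem1:
  fixes n :: nat
  assumes "n \<ge> 1"
  shows "positive_odd_integer
           (2 / (3 * real n * (real n + 1)) *
             (\<Sum>k=1..n. (-1) ^ (n - k) * (real k)^2 * real (delannoy k) * real (delannoy (k - 1))))
       \<and> positive_odd_integer
           (1 / real n *
             (\<Sum>k=1..n. (-1) ^ (n - k) * (4 * (real k)^2 + 2 * real k - 1)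
                * real (delannoy (k - 1)) * little_schroeder k))"
proof -
  obtain m where n: "n = Suc m" using assms by (cases n) auto
  show ?thesis
    unfolding n first_sum_closed_form second_sum_closed_form
    by (intro conjI positive_odd_integer_of_nat sum_powers_of_two_odd)
       (simp_all add: catalan_def)
qed

end
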